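(* Let $Q$ be a $k$-ary quasigroup with $k\ge 3$ whose factorization graph $\Delta(Q)$ is $3$-connected. Then $Q$ is isotopic to an iterated group.
   Context: A $k$-ary quasigroup ($2\le k<\infty$) is a set $Q$ with an operation $f:Q^k\to Q$ such that the equation $f(x_1,\dots,x_k)=x_0$ is uniquely solvable for any one of $x_0,\dots,x_k$ when the other $k$ are given. Operations $f:Q^k\to Q$ and $g:Q_1^k\to Q_1$ are isotopic if there are bijections $\alpha_0,\dots,\alpha_k:Q\to Q_1$ with $g(\alpha_1(x_1),\dots,\alpha_k(x_k))=\alpha_0(f(x_1,\dots,x_k))$ for all $x_i$. An iterated group is a $k$-ary operation of the form $f(x_1,\dots,x_k)=x_1x_2\cdots x_k$ computed in a group. The factorization graph $\Delta(Q)$ has nodes $v_0,v_1,\dots,v_k$, the edges $v_{i-1}v_i$ ($1\le i\le k$) and $v_0v_k$ of the circle $C_{k+1}$, and in addition a chord $v_iv_j$ (for $0\le i$, $i+2\le j\le k$, $(i,j)\ne(0,k)$) whenever $f$ factors as $f(x_1,\dots,x_k)=g(x_1,\dots,x_i,h(x_{i+1},\dots,x_j),x_{j+1},\dots,x_k)$ for some multary quasigroup operations $g,h$ of suitable arities. A $3$-connected graph is inseparable and remains connected after deleting any one or two nodes. *)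

theory Defs
  imports "HOL-Algebra.Group" "HOL-Library.NList" "Graph_Theory.Graph_Theory"
begin

text \<open>
  A \<open>k\<close>-ary operation on \<open>Q\<close> is a function on lists that only matters on \<open>nlists k Q\<close>,
  the lists of length \<open>k\<close> over \<open>Q\<close>; the argument \<open>x\<^sub>i\<close> is the list entry with index \<open>i - 1\<close>.

  Unique solvability for the value \<open>x\<^sub>0\<close> is the closure condition. The carrier is required to be
  nonempty: the empty operation has a complete factorization graph, but it is not isotopic to
  any operation computed in a group.
\<close>

definition multary_quasigroup :: "nat \<Rightarrow> 'a set \<Rightarrow> ('a list \<Rightarrow> 'a) \<Rightarrow> bool" where
  "multary_quasigroup k Q f \<longleftrightarrow>
     2 \<le> k \<and> Q \<noteq> {} \<and>
     (\<forall>xs\<in>nlists k Q. f xs \<in> Q) \<and>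
     (\<forall>xs\<in>nlists k Q. \<forall>i<k. \<forall>y\<in>Q. \<exists>!x. x \<in> Q \<and> f (xs[i := x]) = y)"

definition isotopic ::
  "nat \<Rightarrow> 'a set \<Rightarrow> ('a list \<Rightarrow> 'a) \<Rightarrow> 'b set \<Rightarrow> ('b list \<Rightarrow> 'b) \<Rightarrow> bool" where
  "isotopic k Q f Q' g \<longleftrightarrow>
     (\<exists>\<alpha> :: nat \<Rightarrow> 'a \<Rightarrow> 'b. (\<forall>i\<le>k. bij_betw (\<alpha> i) Q Q') \<and>
        (\<forall>xs\<in>nlists k Q. g (map (\<lambda>i. \<alpha> (Suc i) (xs ! i)) [0..<k]) = \<alpha> 0 (f xs)))"

definition iterated_mult :: "('a, 'm) monoid_scheme \<Rightarrow> 'a list \<Rightarrow> 'a" where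
  "iterated_mult G xs = foldr (\<otimes>\<^bsub>G\<^esub>) xs \<one>\<^bsub>G\<^esub>"

text \<open>
  \<open>f(x\<^sub>1,\<dots>,x\<^sub>k) = g(x\<^sub>1,\<dots>,x\<^sub>i, h(x\<^bsub>i+1\<^esub>,\<dots>,x\<^sub>j), x\<^bsub>j+1\<^esub>,\<dots>,x\<^sub>k)\<close>; here \<open>g\<close> has \<open>i + 1 + (k - j)\<close> arguments
  and \<open>h\<close> has \<open>j - i\<close>.
\<close>

definition factors_at :: "nat \<Rightarrow> 'a set \<Rightarrow> ('a list \<Rightarrow> 'a) \<Rightarrow> nat \<Rightarrow> nat \<Rightarrow> bool" where
  "factors_at k Q f i j \<longleftrightarrow>
     (\<exists>g h. multary_quasigroup (i + 1 + (k - j)) Q g \<and> multary_quasigroup (j - i) Q h \<and>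
        (\<forall>xs\<in>nlists k Q. f xs = g (take i xs @ [h (take (j - i) (drop i xs))] @ drop j xs)))"

text \<open>
  The set below lists each edge once, with the smaller index first; an undirected graph is
  represented by a symmetric digraph.
\<close>

definition factorization_edges :: "nat \<Rightarrow> 'a set \<Rightarrow> ('a list \<Rightarrow> 'a) \<Rightarrow> (nat \<times> nat) set" where
  "factorization_edges k Q f =
     {(i - 1, i) | i. 1 \<le> i \<and> i \<le> k} \<union> {(0, k)} \<union>
     {(i, j) | i j. i + 2 \<le> j \<and> j \<le> k \<and> (i, j) \<noteq> (0, k) \<and> factors_at k Q f i j}"

definition factorization_graph :: "nat \<Rightarrow> 'a set \<Rightarrow> ('a list \<Rightarrow> 'a) \<Rightarrow> nat pair_pre_digraph" where
  "factorization_graph k Q f =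
     \<lparr> pverts = {0..k}, parcs = factorization_edges k Q f \<union> (factorization_edges k Q f)\<inverse> \<rparr>"

text \<open>
  A graph is inseparable if it is connected and has no cut node. The library's
  \<^const>\<open>Digraph_Component.connected\<close> is false for the empty graph, so a one-node graph needs an
  exception when its node is deleted. Loops are not considered.
\<close>

definition inseparable :: "('v, 'e) pre_digraph \<Rightarrow> bool" where
  "inseparable G \<longleftrightarrow> Digraph_Component.connected G \<and>
     \<not> (\<exists>v\<in>verts G. verts G \<noteq> {v} \<and> \<not> Digraph_Component.connected (pre_digraph.del_vert G v))"

definition three_connected :: "('v, 'e) pre_digraph \<Rightarrow> bool" where
  "three_connected G \<longleftrightarrow> inseparable G \<and>
     (\<forall>u\<in>verts G. Digraph_Component.connected (pre_digraph.del_vert G u)) \<and>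
     (\<forall>u\<in>verts G. \<forall>v\<in>verts G. u \<noteq> v \<longrightarrow>
        Digraph_Component.connected (pre_digraph.del_vert (pre_digraph.del_vert G u) v))"

end

theory Submission
  imports Defs
begin

text \<open>
  Let \<open>P i j\<close> say that equality of the values of \<open>f\<close> for two choices of the block
  \<open>x\<^bsub>i+1\<^esub>,\<dots>,x\<^sub>j\<close> does not depend on the remaining arguments. Every edge of the factorization graph
  has this property. By unique solvability, if \<open>i < l < j < m\<close> and both \<open>P i j\<close> and
  \<open>P l m\<close> hold, then \<open>P\<close> holds for every pair of these four nodes. As the nodes lie on a
  circle, 3-connectedness lets any proper clique that contains a separating chord be enlarged: deleting
  two cyclically consecutive nodes of the clique leaves an edge that crosses their chord. So \<open>P\<close> holds
  for all pairs, and after fixing a base point \<open>e\<close> every value of \<open>f\<close> can be computed by the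
  binary operation obtained from the first two arguments, which is associative.
\<close>

section \<open>Blocks of arguments and the notion of separability\<close>

lemma append_split:
  assumes "length xs = m + n"
  obtains ys zs where "xs = ys @ zs" "length ys = m" "length zs = n"
  using assms by (metis append_take_drop_id length_take length_drop add_diff_cancel_left' min.absorb2 le_add1)

locale multary =
  fixes k :: nat and Q :: "'a set" and f :: "'a list \<Rightarrow> 'a"
  assumes quasigroup: "multary_quasigroup k Q f"
begin

lemma f_closed: "length xs = k \<Longrightarrow> set xs \<subseteq> Q \<Longrightarrow> f xs \<in> Q"
  using quasigroup unfolding multary_quasigroup_def by (metis nlistsI)

lemma unique_solution:
  assumes "set u \<subseteq> Q" "set v \<subseteq> Q" "length u + Suc (length v) = k" "y \<in> Q"
  shows "\<exists>!x. x \<in> Q \<and> f (u @ x # v) = y"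
proof -
  have "u @ y # v \<in> nlists k Q"
    by (rule nlistsI) (use assms in auto)
  moreover have "length u < k"
    using assms by simp
  moreover have "\<forall>xs\<in>nlists k Q. \<forall>i<k. \<forall>y\<in>Q. \<exists>!x. x \<in> Q \<and> f (xs[i := x]) = y"
    using quasigroup unfolding multary_quasigroup_def by (elim conjE)
  ultimately have "\<exists>!x. x \<in> Q \<and> f ((u @ y # v)[length u := x]) = y"
    using \<open>y \<in> Q\<close> by (elim ballE[of _ _ "u @ y # v"] allE[of _ "length u"]) simp_all
  then show ?thesis by simp
qed

lemma f_cancel:
  assumes "set u \<subseteq> Q" "set v \<subseteq> Q" "length u + Suc (length v) = k" "x \<in> Q" "x' \<in> Q"
    and "f (u @ x # v) = f (u @ x' # v)"
  shows "x = x'"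
proof -
  have "f (u @ x # v) \<in> Q"
    by (rule f_closed) (use assms in auto)
  then show ?thesis
    using unique_solution[OF assms(1-3)] assms(4-6) by metis
qed

lemma block_solution:
  assumes "set u \<subseteq> Q" "set v \<subseteq> Q" "length u + n + length v = k" "0 < n" "y \<in> Q"
  shows "\<exists>b. set b \<subseteq> Q \<and> length b = n \<and> f (u @ b @ v) = y"
proof -
  \<comment> \<open>The rest of the block is filled arbitrarily, here with \<open>y\<close> as an
    element of \<open>Q\<close> at hand; only its first entry is solved for.\<close>
  let ?r = "replicate (n - 1) y"
  have "\<exists>!x. x \<in> Q \<and> f (u @ x # (?r @ v)) = y"
    by (rule unique_solution) (use assms in auto)
  then obtain x where x: "x \<in> Q" "f (u @ x # (?r @ v)) = y" by blast
  then have "set (x # ?r) \<subseteq> Q \<and> length (x # ?r) = n \<and> f (u @ (x # ?r) @ v) = y"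
    using assms by auto
  then show ?thesis by blast
qed

text \<open>This is the property \<open>P i j\<close> of the introduction. It does without the
  operations \<open>g\<close> and \<open>h\<close>, so it also applies to the edges of the circle,
  where one of them would be unary.\<close>

definition separable :: "nat \<Rightarrow> nat \<Rightarrow> bool" where
  "separable i j \<longleftrightarrow>
     (\<forall>u u' b b' v v'. set u \<subseteq> Q \<longrightarrow> set u' \<subseteq> Q \<longrightarrow> set b \<subseteq> Q \<longrightarrow> set b' \<subseteq> Q \<longrightarrow> set v \<subseteq> Q \<longrightarrow> set v' \<subseteq> Q \<longrightarrow>
        length u = i \<longrightarrow> length u' = i \<longrightarrow> length b = j - i \<longrightarrow> length b' = j - i \<longrightarrow>
        length v = k - j \<longrightarrow> length v' = k - j \<longrightarrow>
        f (u @ b @ v) = f (u @ b' @ v) \<longrightarrow> f (u' @ b @ v') = f (u' @ b' @ v'))"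

lemma separableD:
  assumes "separable i j" "f (u @ b @ v) = f (u @ b' @ v)"
    "length u = i" "length b = j - i" "length v = k - j"
    "length u' = i" "length b' = j - i" "length v' = k - j"
    "set u \<subseteq> Q" "set b \<subseteq> Q" "set v \<subseteq> Q" "set u' \<subseteq> Q" "set b' \<subseteq> Q" "set v' \<subseteq> Q"
  shows "f (u' @ b @ v') = f (u' @ b' @ v')"
  using assms(1)[unfolded separable_def, rule_format,
      OF assms(9,12,10,13,11,14,3,6,4,7,5,8,2)] .

lemma separable_singleton:
  assumes "i < k" shows "separable i (Suc i)"
  unfolding separable_def
proof (intro allI impI)
  fix u u' b b' v v' :: "'a list"
  assume *: "set u \<subseteq> Q" "set b \<subseteq> Q" "set b' \<subseteq> Q" "set v \<subseteq> Q" "length u = i"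
    "length b = Suc i - i" "length b' = Suc i - i" "length v = k - Suc i"
    and eq: "f (u @ b @ v) = f (u @ b' @ v)"
  then have "length b = 1" "length b' = 1"
    by simp_all
  then obtain x x' where b: "b = [x]" "b' = [x']"
    by (metis One_nat_def length_0_conv length_Suc_conv)
  have "x = x'"
    by (rule f_cancel[of u v]) (use * eq b assms in simp_all)
  then show "f (u' @ b @ v') = f (u' @ b' @ v')"
    by (simp add: b)
qed

lemma separable_full: "separable 0 k"
  by (simp add: separable_def)

text \<open>Cancelling in \<open>g\<close> turns equality of the two values of \<open>f\<close> into
  \<open>h b = h b'\<close>, a condition from which the outer arguments have disappeared.\<close>

lemma separable_if_factors_at:
  assumes ij: "i < j" "j \<le> k" and fac: "factors_at k Q f i j"
  shows "separable i j"
proof -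
  obtain g h where g: "multary_quasigroup (i + 1 + (k - j)) Q g"
    and h: "multary_quasigroup (j - i) Q h"
    and f: "\<And>xs. xs \<in> nlists k Q \<Longrightarrow> f xs = g (take i xs @ [h (take (j - i) (drop i xs))] @ drop j xs)"
    using fac unfolding factors_at_def by blast
  interpret g: multary "i + 1 + (k - j)" Q g
    by unfold_locales (rule g)
  interpret h: multary "j - i" Q h
    by unfold_locales (rule h)
  have f': "f (u @ b @ v) = g (u @ h b # v)"
    if "set u \<subseteq> Q" "set b \<subseteq> Q" "set v \<subseteq> Q" "length u = i" "length b = j - i" "length v = k - j"
    for u b v
  proof -
    have "u @ b @ v \<in> nlists k Q"
      by (rule nlistsI) (use that ij in auto)
    then show ?thesis
      using that ij f[of "u @ b @ v"] by simp
  qed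
  show ?thesis
    unfolding separable_def
  proof (intro allI impI)
    fix u u' b b' v v' :: "'a list"
    assume *: "set u \<subseteq> Q" "set u' \<subseteq> Q" "set b \<subseteq> Q" "set b' \<subseteq> Q" "set v \<subseteq> Q" "set v' \<subseteq> Q"
      "length u = i" "length u' = i" "length b = j - i" "length b' = j - i"
      "length v = k - j" "length v' = k - j"
      and eq: "f (u @ b @ v) = f (u @ b' @ v)"
    have "g (u @ h b # v) = g (u @ h b' # v)"
      using eq f'[of u b v] f'[of u b' v] * by simp
    then have "h b = h b'"
      by (intro g.f_cancel[of u v "h b" "h b'"]) (use * h.f_closed in simp_all)
    then show "f (u' @ b @ v') = f (u' @ b' @ v')"
      using f'[of u' b v'] f'[of u' b' v'] * by simp
  qed
qed

text \<open>The four nodes cut the arguments into segments \<open>A\<close>, \<open>B\<close>,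
  \<open>C\<close>, \<open>D\<close>, \<open>E\<close>. The facts \<open>BC\<close> and
  \<open>CD\<close> are the two hypotheses in this notation. The facts \<open>B\<close>,
  \<open>C\<close>, \<open>D\<close> derive from them that equality for two values of a single
  segment survives any change of the other four.\<close>

lemma separable_crossing:
  assumes ord: "i < l" "l < j" "j < m" "m \<le> k"
    and ij: "separable i j" and lm: "separable l m"
  shows "separable i l" "separable l j" "separable j m" "separable i m"
proof -
  have total: "i + (l - i + (j - l + (m - j + (k - m)))) = k"
    using ord by simp
  have gaps: "i + (l - i) = l" "l - i + (j - l) = j - i" "j - l + (m - j) = m - l"
    "m - j + (k - m) = k - j"
    using ord by simp_all
  have BC: "f (A' @ B @ C @ D' @ E') = f (A' @ B' @ C' @ D' @ E')"
    if "f (A @ B @ C @ D @ E) = f (A @ B' @ C' @ D @ E)"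
      "length A = i" "length B = l - i" "length C = j - l" "length D = m - j" "length E = k - m"
      "length A' = i" "length B' = l - i" "length C' = j - l" "length D' = m - j" "length E' = k - m"
      "set A \<subseteq> Q" "set B \<subseteq> Q" "set C \<subseteq> Q" "set D \<subseteq> Q" "set E \<subseteq> Q"
      "set A' \<subseteq> Q" "set B' \<subseteq> Q" "set C' \<subseteq> Q" "set D' \<subseteq> Q" "set E' \<subseteq> Q"
    for A B C D E A' B' C' D' E'
  proof -
    have "f (A' @ (B @ C) @ (D' @ E')) = f (A' @ (B' @ C') @ (D' @ E'))"
      by (rule separableD[OF ij, of A "B @ C" "D @ E"]) (simp_all add: that gaps)
    then show ?thesis by simp
  qed
  have CD: "f (A' @ B' @ C @ D @ E') = f (A' @ B' @ C' @ D' @ E')"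
    if "f (A @ B @ C @ D @ E) = f (A @ B @ C' @ D' @ E)"
      "length A = i" "length B = l - i" "length C = j - l" "length D = m - j" "length E = k - m"
      "length A' = i" "length B' = l - i" "length C' = j - l" "length D' = m - j" "length E' = k - m"
      "set A \<subseteq> Q" "set B \<subseteq> Q" "set C \<subseteq> Q" "set D \<subseteq> Q" "set E \<subseteq> Q"
      "set A' \<subseteq> Q" "set B' \<subseteq> Q" "set C' \<subseteq> Q" "set D' \<subseteq> Q" "set E' \<subseteq> Q"
    for A B C D E A' B' C' D' E'
  proof -
    have "f ((A' @ B') @ (C @ D) @ E') = f ((A' @ B') @ (C' @ D') @ E')"
      by (rule separableD[OF lm, of "A @ B" "C @ D" E]) (simp_all add: that gaps)
    then show ?thesis by simp
  qed
  have B: "f (A' @ B @ C' @ D' @ E') = f (A' @ B' @ C' @ D' @ E')"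
    if eq: "f (A @ B @ C @ D @ E) = f (A @ B' @ C @ D @ E)"
      and len: "length A = i" "length B = l - i" "length C = j - l" "length D = m - j" "length E = k - m"
      "length A' = i" "length B' = l - i" "length C' = j - l" "length D' = m - j" "length E' = k - m"
      and set: "set A \<subseteq> Q" "set B \<subseteq> Q" "set C \<subseteq> Q" "set D \<subseteq> Q" "set E \<subseteq> Q"
      "set A' \<subseteq> Q" "set B' \<subseteq> Q" "set C' \<subseteq> Q" "set D' \<subseteq> Q" "set E' \<subseteq> Q"
    for A B C D E A' B' C' D' E'
  proof -
    \<comment> \<open>\<open>BC\<close> can change \<open>A\<close>, \<open>D\<close> and
      \<open>E\<close> but must leave \<open>C\<close> alone. To change \<open>C\<close> as well,
      solve for \<open>D1\<close> such that \<open>C' D1\<close> can replace \<open>C D\<close>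
      after \<open>B\<close>; by \<open>CD\<close> it can then replace \<open>C D\<close> after
      \<open>B'\<close> too.\<close>
    have "f (A @ B @ C @ D @ E) \<in> Q"
      by (rule f_closed) (simp_all add: len set total)
    then have "\<exists>D1. set D1 \<subseteq> Q \<and> length D1 = m - j \<and> f ((A @ B @ C') @ D1 @ E) = f (A @ B @ C @ D @ E)"
      by (intro block_solution) (simp_all add: len set ord(1-3) total add.assoc)
    then obtain D1 where D1: "set D1 \<subseteq> Q" "length D1 = m - j" "f ((A @ B @ C') @ D1 @ E) = f (A @ B @ C @ D @ E)"
      by blast
    then have 1: "f (A @ B @ C @ D @ E) = f (A @ B @ C' @ D1 @ E)"
      by simp
    have "f (A @ B' @ C @ D @ E) = f (A @ B' @ C' @ D1 @ E)"
      by (rule CD[OF 1]) (simp_all add: len set D1)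
    then have "f (A @ B @ C' @ D1 @ E) = f (A @ B' @ C' @ D1 @ E)"
      using 1 eq by simp
    then show ?thesis
      by (rule BC) (simp_all add: len set D1)
  qed
  have C: "f (A' @ B' @ C @ D' @ E') = f (A' @ B' @ C' @ D' @ E')"
    if eq: "f (A @ B @ C @ D @ E) = f (A @ B @ C' @ D @ E)"
      and len: "length A = i" "length B = l - i" "length C = j - l" "length D = m - j" "length E = k - m"
      "length A' = i" "length B' = l - i" "length C' = j - l" "length D' = m - j" "length E' = k - m"
      and set: "set A \<subseteq> Q" "set B \<subseteq> Q" "set C \<subseteq> Q" "set D \<subseteq> Q" "set E \<subseteq> Q"
      "set A' \<subseteq> Q" "set B' \<subseteq> Q" "set C' \<subseteq> Q" "set D' \<subseteq> Q" "set E' \<subseteq> Q"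
    for A B C D E A' B' C' D' E'
  proof -
    \<comment> \<open>Nothing has to be solved here: \<open>BC\<close> changes \<open>D\<close>,
      after which \<open>CD\<close> changes \<open>A\<close>, \<open>B\<close> and
      \<open>E\<close>.\<close>
    have "f (A @ B @ C @ D' @ E) = f (A @ B @ C' @ D' @ E)"
      by (rule BC[OF eq]) (simp_all add: len set)
    then show ?thesis
      by (rule CD) (simp_all add: len set)
  qed
  have D: "f (A' @ B' @ C' @ D @ E') = f (A' @ B' @ C' @ D' @ E')"
    if eq: "f (A @ B @ C @ D @ E) = f (A @ B @ C @ D' @ E)"
      and len: "length A = i" "length B = l - i" "length C = j - l" "length D = m - j" "length E = k - m"
      "length A' = i" "length B' = l - i" "length C' = j - l" "length D' = m - j" "length E' = k - m"
      and set: "set A \<subseteq> Q" "set B \<subseteq> Q" "set C \<subseteq> Q" "set D \<subseteq> Q" "set E \<subseteq> Q"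
      "set A' \<subseteq> Q" "set B' \<subseteq> Q" "set C' \<subseteq> Q" "set D' \<subseteq> Q" "set E' \<subseteq> Q"
    for A B C D E A' B' C' D' E'
  proof -
    \<comment> \<open>Mirror image of the argument for \<open>B\<close>: now \<open>B1 C'\<close>
      replaces \<open>B C\<close>.\<close>
    have "f (A @ B @ C @ D @ E) \<in> Q"
      by (rule f_closed) (simp_all add: len set total)
    then have "\<exists>B1. set B1 \<subseteq> Q \<and> length B1 = l - i \<and> f (A @ B1 @ C' @ D @ E) = f (A @ B @ C @ D @ E)"
      by (intro block_solution) (simp_all add: len set ord(1-3) total add.assoc)
    then obtain B1 where B1: "set B1 \<subseteq> Q" "length B1 = l - i" "f (A @ B1 @ C' @ D @ E) = f (A @ B @ C @ D @ E)"
      by blast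
    have "f (A @ B1 @ C' @ D' @ E) = f (A @ B @ C @ D' @ E)"
      by (rule BC[OF B1(3)]) (simp_all add: len set B1)
    then have "f (A @ B1 @ C' @ D @ E) = f (A @ B1 @ C' @ D' @ E)"
      using B1 eq by simp
    then show ?thesis
      by (rule CD) (simp_all add: len set B1)
  qed
  show "separable i l"
    unfolding separable_def
  proof (intro allI impI)
    fix u u' b b' v v' :: "'a list"
    assume *: "set u \<subseteq> Q" "set u' \<subseteq> Q" "set b \<subseteq> Q" "set b' \<subseteq> Q" "set v \<subseteq> Q" "set v' \<subseteq> Q"
      "length u = i" "length u' = i" "length b = l - i" "length b' = l - i"
      "length v = k - l" "length v' = k - l"
      and eq: "f (u @ b @ v) = f (u @ b' @ v)"
    have "\<exists>X Y Z. w = X @ Y @ Z \<and> length X = j - l \<and> length Y = m - j \<and> length Z = k - m"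
      if "length w = k - l" for w :: "'a list"
    proof -
      have "length w = (j - l) + ((m - j) + (k - m))" using that ord by simp
      then show ?thesis by (metis append_split)
    qed
    from this[of v] this[of v'] * obtain X Y Z X' Y' Z' where
      "v = X @ Y @ Z" "length X = j - l" "length Y = m - j" "length Z = k - m"
      "v' = X' @ Y' @ Z'" "length X' = j - l" "length Y' = m - j" "length Z' = k - m"
      by metis
    then show "f (u' @ b @ v') = f (u' @ b' @ v')"
      using B[of u b X Y Z b' u' X' Y' Z'] * eq by simp
  qed
  show "separable l j"
    unfolding separable_def
  proof (intro allI impI)
    fix u u' b b' v v' :: "'a list"
    assume *: "set u \<subseteq> Q" "set u' \<subseteq> Q" "set b \<subseteq> Q" "set b' \<subseteq> Q" "set v \<subseteq> Q" "set v' \<subseteq> Q"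
      "length u = l" "length u' = l" "length b = j - l" "length b' = j - l"
      "length v = k - j" "length v' = k - j"
      and eq: "f (u @ b @ v) = f (u @ b' @ v)"
    have "length u = i + (l - i)" "length u' = i + (l - i)"
      "length v = (m - j) + (k - m)" "length v' = (m - j) + (k - m)"
      using * ord by simp_all
    then obtain X Y Z W X' Y' Z' W' where
      "u = X @ Y" "length X = i" "length Y = l - i" "u' = X' @ Y'" "length X' = i" "length Y' = l - i"
      "v = Z @ W" "length Z = m - j" "length W = k - m" "v' = Z' @ W'" "length Z' = m - j" "length W' = k - m"
      by (elim append_split)
    then show "f (u' @ b @ v') = f (u' @ b' @ v')"
      using C[of X Y b Z W b' X' Y' Z' W'] * eq by simp
  qed
  show "separable j m"
    unfolding separable_def
  proof (intro allI impI)
    fix u u' b b' v v' :: "'a list"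
    assume *: "set u \<subseteq> Q" "set u' \<subseteq> Q" "set b \<subseteq> Q" "set b' \<subseteq> Q" "set v \<subseteq> Q" "set v' \<subseteq> Q"
      "length u = j" "length u' = j" "length b = m - j" "length b' = m - j"
      "length v = k - m" "length v' = k - m"
      and eq: "f (u @ b @ v) = f (u @ b' @ v)"
    have "\<exists>X Y Z. w = X @ Y @ Z \<and> length X = i \<and> length Y = l - i \<and> length Z = j - l"
      if "length w = j" for w :: "'a list"
    proof -
      have "length w = i + ((l - i) + (j - l))" using that ord by simp
      then show ?thesis by (metis append_split)
    qed
    from this[of u] this[of u'] * obtain X Y Z X' Y' Z' where
      "u = X @ Y @ Z" "length X = i" "length Y = l - i" "length Z = j - l"
      "u' = X' @ Y' @ Z'" "length X' = i" "length Y' = l - i" "length Z' = j - l"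
      by metis
    then show "f (u' @ b @ v') = f (u' @ b' @ v')"
      using D[of X Y Z b v b' X' Y' Z' v'] * eq by simp
  qed
  show "separable i m"
    unfolding separable_def
  proof (intro allI impI)
    fix u u' b b' v v' :: "'a list"
    assume *: "set u \<subseteq> Q" "set u' \<subseteq> Q" "set b \<subseteq> Q" "set b' \<subseteq> Q" "set v \<subseteq> Q" "set v' \<subseteq> Q"
      "length u = i" "length u' = i" "length b = m - i" "length b' = m - i"
      "length v = k - m" "length v' = k - m"
      and eq: "f (u @ b @ v) = f (u @ b' @ v)"
    have "\<exists>X Y Z. w = X @ Y @ Z \<and> length X = l - i \<and> length Y = j - l \<and> length Z = m - j"
      if "length w = m - i" for w :: "'a list"
    proof -
      have "length w = (l - i) + ((j - l) + (m - j))" using that ord by simp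
      then show ?thesis by (metis append_split)
    qed
    from this[of b] this[of b'] * obtain X Y Z X' Y' Z' where
      b: "b = X @ Y @ Z" and len: "length X = l - i" "length Y = j - l" "length Z = m - j" and
      b': "b' = X' @ Y' @ Z'" and len': "length X' = l - i" "length Y' = j - l" "length Z' = m - j"
      by metis
    have set: "set X \<subseteq> Q" "set Y \<subseteq> Q" "set Z \<subseteq> Q" "set X' \<subseteq> Q" "set Y' \<subseteq> Q" "set Z' \<subseteq> Q"
      using * b b' by auto
    \<comment> \<open>Pass from \<open>X Y Z\<close> to \<open>X' Y' Z'\<close> in three moves of
      equal value: to \<open>X Y1 Z'\<close> by \<open>CD\<close>, to \<open>X1 Y' Z'\<close> by
      \<open>BC\<close>, and to \<open>X' Y' Z'\<close> by \<open>B\<close>. The entries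
      \<open>Y1\<close> and \<open>X1\<close> are solved for in the context \<open>u\<close>,
      \<open>v\<close>, and each move carries over to \<open>u'\<close>, \<open>v'\<close>.\<close>
    have "f (u @ X @ Y @ Z @ v) \<in> Q"
      by (rule f_closed) (simp_all add: * len set total)
    then have "\<exists>Y1. set Y1 \<subseteq> Q \<and> length Y1 = j - l \<and> f ((u @ X) @ Y1 @ Z' @ v) = f (u @ X @ Y @ Z @ v)"
      by (intro block_solution) (simp_all add: * len len' set ord(1-3) total add.assoc)
    then obtain Y1 where Y1: "set Y1 \<subseteq> Q" "length Y1 = j - l" "f ((u @ X) @ Y1 @ Z' @ v) = f (u @ X @ Y @ Z @ v)"
      by blast
    have "f (u @ X @ Y1 @ Z' @ v) \<in> Q"
      by (rule f_closed) (simp_all add: * len len' set Y1 total)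
    then have "\<exists>X1. set X1 \<subseteq> Q \<and> length X1 = l - i \<and> f (u @ X1 @ Y' @ Z' @ v) = f (u @ X @ Y1 @ Z' @ v)"
      by (intro block_solution) (simp_all add: * len len' set Y1 ord(1-3) total add.assoc)
    then obtain X1 where X1: "set X1 \<subseteq> Q" "length X1 = l - i" "f (u @ X1 @ Y' @ Z' @ v) = f (u @ X @ Y1 @ Z' @ v)"
      by blast
    have "f (u' @ X @ Y1 @ Z' @ v') = f (u' @ X @ Y @ Z @ v')"
      by (rule CD[of u X Y1 Z' v Y Z]) (use Y1(3) in \<open>simp_all add: * len len' set Y1(1,2)\<close>)
    moreover have "f (u' @ X1 @ Y' @ Z' @ v') = f (u' @ X @ Y1 @ Z' @ v')"
      by (rule BC[OF X1(3)]) (simp_all add: * len len' set Y1 X1)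
    moreover have "f (u @ X1 @ Y' @ Z' @ v) = f (u @ X' @ Y' @ Z' @ v)"
      using X1(3) Y1(3) eq b b' by simp
    then have "f (u' @ X1 @ Y' @ Z' @ v') = f (u' @ X' @ Y' @ Z' @ v')"
      by (rule B) (simp_all add: * len len' set Y1 X1)
    ultimately show "f (u' @ b @ v') = f (u' @ b' @ v')"
      by (simp add: b b')
  qed
qed

end

section \<open>Growing a clique among points on a circle\<close>

text \<open>
  The clique is kept inside \<open>{0..k}\<close> together with the edge \<open>{0, k}\<close>, so that cyclically
  consecutive nodes around a missing one are also consecutive in the linear order.
\<close>

lemma complete_if_crossing_closed:
  fixes R :: "nat \<Rightarrow> nat \<Rightarrow> bool" and k :: nat
  assumes k: "2 < k"
    and sym: "\<And>x y. R x y \<longleftrightarrow> R y x"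
    and circle: "R 0 k"
    and crossing: "\<And>i l j m. i < l \<Longrightarrow> l < j \<Longrightarrow> j < m \<Longrightarrow> m \<le> k \<Longrightarrow> R i j \<Longrightarrow> R l m \<Longrightarrow>
      R i l \<and> R l j \<and> R j m \<and> R i m"
    and cut: "\<And>a b p q. a < p \<Longrightarrow> p < b \<Longrightarrow> b \<le> k \<Longrightarrow> q \<le> k \<Longrightarrow> q < a \<or> b < q \<Longrightarrow>
      \<exists>p' q'. a < p' \<and> p' < b \<and> q' \<le> k \<and> (q' < a \<or> b < q') \<and> R p' q'"
    and xy: "x \<le> k" "y \<le> k" "x \<noteq> y"
  shows "R x y"
proof -
  \<comment> \<open>The first goal is a triangle on \<open>0\<close>, \<open>k\<close> and a third
    node. Deleting \<open>1\<close> and \<open>k\<close> leaves an edge from \<open>0\<close> to a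
    node of \<open>T\<close>; take the largest such node \<open>?q\<close>. Deleting
    \<open>0\<close> and \<open>?q\<close> leaves an edge crossing the chord from \<open>0\<close>
    to \<open>?q\<close>. Its far end \<open>r\<close> is then joined to \<open>0\<close> and to
    \<open>?q\<close>, so maximality forces \<open>r = k\<close>.\<close>
  define T where "T = {q. 1 < q \<and> q < k \<and> R 0 q}"
  obtain p' q' where "1 < p'" "p' < k" "q' \<le> k" "q' < 1 \<or> k < q'" "R p' q'"
    using cut[of 1 2 k 0] k by auto
  then have "p' \<in> T"
    using sym by (auto simp: T_def)
  moreover have finT: "finite T"
    by (simp add: T_def)
  ultimately have q: "Max T \<in> T" (is "?q \<in> T")
    using Max_in by blast
  then obtain p r where pr: "0 < p" "p < ?q" "r \<le> k" "?q < r" "R p r"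
    using cut[of 0 1 ?q k] by (auto simp: T_def)
  then have "R ?q r" "R 0 r"
    using crossing[of 0 p ?q r] q by (auto simp: T_def)
  moreover have "r \<notin> T"
    using pr finT Max_ge by (meson leD)
  ultimately have qk: "R ?q k"
    using pr by (auto simp: T_def)

  \<comment> \<open>Requiring \<open>?q\<close> excludes a gap of the clique with
    \<open>a = 0\<close> and \<open>b = k\<close>: outside such a gap no node would be left for
    \<open>cut\<close> to reach.\<close>
  define clique where
    "clique S \<longleftrightarrow> {0, ?q, k} \<subseteq> S \<and> S \<subseteq> {0..k} \<and> (\<forall>x\<in>S. \<forall>y\<in>S. x \<noteq> y \<longrightarrow> R x y)" for S
  have "clique {0, ?q, k}"
    using q qk circle sym by (auto simp: clique_def T_def)
  moreover have "finite {S. clique S}"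
    by (rule finite_subset[of _ "Pow {0..k}"]) (auto simp: clique_def)
  ultimately obtain S where S: "clique S" and max: "\<And>S'. clique S' \<Longrightarrow> S \<subseteq> S' \<Longrightarrow> S = S'"
    using finite_has_maximal[of "{S. clique S}"] by blast
  have RS: "R s t" if "s \<in> S" "t \<in> S" "s \<noteq> t" for s t
    using S that by (auto simp: clique_def)
  have Sk: "s \<le> k" if "s \<in> S" for s
    using S that by (auto simp: clique_def)
  have finS: "finite S"
    using S finite_subset by (auto simp: clique_def)
  have "S = {0..k}"
  proof (rule ccontr)
    assume "S \<noteq> {0..k}"
    moreover have "S \<subseteq> {0..k}"
      using S by (simp add: clique_def)
    ultimately obtain p where p: "p \<le> k" "p \<notin> S"
      by (metis atLeastAtMost_iff subsetI subset_antisym)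
    define a where "a = Max {s\<in>S. s < p}"
    define b where "b = Min {s\<in>S. p < s}"
    have "0 \<in> S" "k \<in> S" "?q \<in> S"
      using S by (auto simp: clique_def)
    with p have "0 < p" "p < k"
      by (auto simp: le_less intro: gr0I)
    have ab: "a \<in> S" "a < p" "b \<in> S" "p < b"
    proof -
      have "{s\<in>S. s < p} \<noteq> {}" "{s\<in>S. p < s} \<noteq> {}"
        using \<open>0 \<in> S\<close> \<open>k \<in> S\<close> \<open>0 < p\<close> \<open>p < k\<close> by blast+
      then have "a \<in> {s\<in>S. s < p}" "b \<in> {s\<in>S. p < s}"
        unfolding a_def b_def using finS by (intro Max_in Min_in; simp)+
      then show "a \<in> S" "a < p" "b \<in> S" "p < b" by simp_all
    qed
    have gap: "s \<le> a \<or> b \<le> s" if "s \<in> S" for s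
    proof (cases "s < p")
      case True
      then show ?thesis using that finS by (simp add: a_def)
    next
      case False
      then have "p < s" using that p by (metis linorder_neqE_nat)
      then show ?thesis using that finS by (simp add: b_def)
    qed
    have "\<exists>s\<in>S. s < a \<or> b < s"
    proof (rule ccontr)
      assume "\<not> ?thesis"
      then have "\<not> 0 < a" "\<not> b < k" "\<not> ?q < a" "\<not> b < ?q"
        using \<open>0 \<in> S\<close> \<open>k \<in> S\<close> \<open>?q \<in> S\<close> by auto
      then have "a = 0" "k \<le> b" by auto
      then show False
        using gap[OF \<open>?q \<in> S\<close>] q by (auto simp: T_def)
    qed
    then obtain p' q' where p': "a < p'" "p' < b" "q' \<le> k" "q' < a \<or> b < q'" "R p' q'"
      using cut[of a p b] ab Sk by blast
    \<comment> \<open>The node \<open>q'\<close> need not belong to the clique. Since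
      \<open>p' q'\<close> crosses the chord \<open>a b\<close>, \<open>p'\<close> is joined to
      \<open>a\<close> and \<open>b\<close>. For every other \<open>s \<noteq> q'\<close> in the
      clique, one of the chords \<open>s a\<close> and \<open>s b\<close> crosses
      \<open>p' q'\<close>, and this crossing joins \<open>p'\<close> to \<open>s\<close>. The cases
      only sort the positions around the circle.\<close>
    have "R p' s" if s: "s \<in> S" for s
    proof (cases "q' < a")
      case True
      have c: "R a p' \<and> R p' b"
        using crossing[of q' a p' b] True p' ab Sk RS[of a b] sym by auto
      consider "s = a" | "s = b" | "s = q'" | "s < q'" | "q' < s" "s < a" | "b < s"
        using gap[OF s] by linarith
      then show ?thesis
      proof cases
        case 4
        then show ?thesis
          using crossing[of s q' a p'] True p' ab Sk[of b] RS[of s a] sym s by auto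
      next
        case 5
        then show ?thesis
          using crossing[of q' s p' b] True p' ab Sk[of b] RS[of s b] sym s by auto
      next
        case 6
        then show ?thesis
          using crossing[of q' a p' s] True p' ab Sk[of s] RS[of a s] sym s by auto
      qed (use c p' sym in auto)
    next
      case False
      then have "b < q'" using p' by simp
      have c: "R a p' \<and> R p' b"
        using crossing[of a p' b q'] \<open>b < q'\<close> p' ab RS[of a b] by auto
      consider "s = a" | "s = b" | "s = q'" | "q' < s" | "b < s" "s < q'" | "s < a"
        using gap[OF s] by linarith
      then show ?thesis
      proof cases
        case 4
        then show ?thesis
          using crossing[of p' b q' s] \<open>b < q'\<close> p' ab Sk[of s] RS[of b s] sym s by auto
      next
        case 5
        then show ?thesis
          using crossing[of a p' s q'] \<open>b < q'\<close> p' ab RS[of a s] sym s by auto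
      next
        case 6
        then show ?thesis
          using crossing[of s p' b q'] \<open>b < q'\<close> p' ab RS[of s b] sym s by auto
      qed (use c p' sym in auto)
    qed
    moreover have "p' \<le> k"
      using p' ab Sk[of b] by simp
    ultimately have "clique (insert p' S)"
      using S sym RS unfolding clique_def by auto
    then have "p' \<in> S"
      using max[of "insert p' S"] by auto
    then show False
      using gap p' by force
  qed
  then show ?thesis
    using RS xy by simp
qed

section \<open>From 3-connectedness to separability of all blocks\<close>

text \<open>A walk from \<open>u\<close> to \<open>w\<close> has to leave \<open>U\<close> at some
  arc. Connectedness concerns the symmetric closure, hence the two orientations in the
  conclusion.\<close>

lemma connected_edge_across:
  assumes "Digraph_Component.connected G" "u \<in> verts G" "w \<in> verts G" "u \<in> U" "w \<notin> U"
  obtains x y where "x \<in> verts G" "y \<in> verts G" "x \<in> U" "y \<notin> U"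
    "(x, y) \<in> arcs_ends G \<or> (y, x) \<in> arcs_ends G"
proof -
  have "u \<rightarrow>\<^sup>*\<^bsub>with_proj (mk_symmetric G)\<^esub> w"
    using assms by (auto simp: Digraph_Component.connected_def strongly_connected_def)
  then have "(u, w) \<in> rtrancl_on (verts G) (arcs_ends (with_proj (mk_symmetric G)))"
    by (simp add: reachable_def)
  then have "w \<in> U \<or> (\<exists>x y. x \<in> verts G \<and> y \<in> verts G \<and> x \<in> U \<and> y \<notin> U \<and>
      (x, y) \<in> arcs_ends (with_proj (mk_symmetric G)))"
  proof (induction rule: rtrancl_on_induct)
    case base
    then show ?case using assms by simp
  next
    case (step y z)
    then show ?case by blast
  qed
  moreover have "arcs_ends (with_proj (mk_symmetric G)) \<subseteq> arcs_ends G \<union> (arcs_ends G)\<inverse>"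
    by (auto simp: parcs_mk_symmetric arcs_ends_def arc_to_ends_def)
  ultimately show thesis
    using that assms(5) by blast
qed

context multary
begin

text \<open>Supplies the hypothesis \<open>cut\<close> of
  \<open>complete_if_crossing_closed\<close>: the graph without \<open>a\<close> and
  \<open>b\<close> is connected and has nodes both inside and outside the open interval between
  them.\<close>

lemma edge_across_cut:
  assumes conn: "three_connected (with_proj (factorization_graph k Q f))"
    and ab: "a < p" "p < b" "b \<le> k" and q: "q \<le> k" "q < a \<or> b < q"
  shows "\<exists>p' q'. a < p' \<and> p' < b \<and> q' \<le> k \<and> (q' < a \<or> b < q') \<and>
    (p', q') \<in> factorization_edges k Q f \<union> (factorization_edges k Q f)\<inverse>"
proof -
  let ?G = "with_proj (factorization_graph k Q f)"
  let ?H = "pre_digraph.del_vert (pre_digraph.del_vert ?G a) b"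
  have "Digraph_Component.connected ?H"
    using conn ab by (auto simp: three_connected_def factorization_graph_def)
  moreover have V: "verts ?H = {0..k} - {a, b}"
    by (auto simp: pre_digraph.verts_del_vert factorization_graph_def)
  moreover have "p \<in> verts ?H" "q \<in> verts ?H"
    unfolding V using ab q by auto
  ultimately obtain x y where xy: "x \<in> verts ?H" "y \<in> verts ?H" "x \<in> {a<..<b}" "y \<notin> {a<..<b}"
    "(x, y) \<in> arcs_ends ?H \<or> (y, x) \<in> arcs_ends ?H"
    using connected_edge_across[of ?H p q "{a<..<b}"] ab q by (metis greaterThanLessThan_iff not_less_iff_gr_or_eq)
  have "arcs_ends ?H \<subseteq> factorization_edges k Q f \<union> (factorization_edges k Q f)\<inverse>"
    by (auto simp: arcs_ends_def arc_to_ends_def pre_digraph.del_vert_def factorization_graph_def)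
  then have "(x, y) \<in> factorization_edges k Q f \<union> (factorization_edges k Q f)\<inverse>"
    using xy(5) by auto
  moreover have "x \<in> {0..k} - {a, b}" "y \<in> {0..k} - {a, b}"
    using xy(1,2) by (simp_all only: V)
  then have "a < x" "x < b" "y \<le> k" "y < a \<or> b < y"
    using xy(3,4) by auto
  ultimately show ?thesis
    by blast
qed

lemma separable_if_edge:
  assumes "(i, j) \<in> factorization_edges k Q f"
  shows "separable i j \<and> i < j"
proof -
  have "0 < k"
    using quasigroup unfolding multary_quasigroup_def by linarith
  moreover have "separable (j - 1) j" if "1 \<le> j" "j \<le> k"
    using separable_singleton[of "j - 1"] that by simp
  ultimately show ?thesis
    using assms separable_full separable_if_factors_at by (auto simp: factorization_edges_def)
qed

lemma all_separable:
  assumes conn: "three_connected (with_proj (factorization_graph k Q f))"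
    and "3 \<le> k" "i < j" "j \<le> k"
  shows "separable i j"
proof -
  \<comment> \<open>\<open>separable\<close> is meant for ordered pairs; sorting the two ends makes
    it a symmetric relation on the nodes.\<close>
  let ?R = "\<lambda>x y. separable (min x y) (max x y)"
  have "?R i j"
  proof (rule complete_if_crossing_closed[where R = ?R and k = k])
    show "\<exists>p' q'. a < p' \<and> p' < b \<and> q' \<le> k \<and> (q' < a \<or> b < q') \<and> ?R p' q'"
      if "a < p" "p < b" "b \<le> k" "q \<le> k" "q < a \<or> b < q" for a b p q
    proof -
      have "?R x y" if "(x, y) \<in> factorization_edges k Q f \<union> (factorization_edges k Q f)\<inverse>" for x y
        using that separable_if_edge by (force simp: min_def max_def)
      then show ?thesis
        using edge_across_cut[OF conn that] by blast
    qed
  next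
    show "?R i' l \<and> ?R l j' \<and> ?R j' m \<and> ?R i' m"
      if "i' < l" "l < j'" "j' < m" "m \<le> k" "?R i' j'" "?R l m" for i' l j' m
      using separable_crossing[of i' l j' m] that by simp
  next
    show "?R x y \<longleftrightarrow> ?R y x" for x y
      by (simp add: min.commute max.commute)
  qed (use assms separable_full in simp_all)
  then show ?thesis
    using assms by (simp add: min_def max_def)
qed

end

section \<open>The group and the isotopy\<close>

text \<open>\<open>iterated_mult\<close> unfolds at the head of the list, whereas the later
  induction on prefixes adds factors at the end.\<close>

lemma (in monoid) iterated_mult_snoc:
  assumes "set xs \<subseteq> carrier G" "x \<in> carrier G"
  shows "iterated_mult G xs \<in> carrier G \<and> iterated_mult G (xs @ [x]) = iterated_mult G xs \<otimes> x"
  using assms by (induction xs) (auto simp: iterated_mult_def m_assoc)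

locale separable_multary = multary +
  fixes e :: 'a
  assumes arity: "3 \<le> k" and e: "e \<in> Q"
    and separable: "\<And>i j. i < j \<Longrightarrow> j \<le> k \<Longrightarrow> separable i j"
begin

lemma set_replicate_e [simp]: "set (replicate n e) \<subseteq> Q"
  using e by (simp add: set_replicate_conv_if)

text \<open>These translations become the components of the isotopy. All of them send
  \<open>e\<close> to the same element, which serves as the unit.\<close>

definition \<phi> :: "nat \<Rightarrow> 'a \<Rightarrow> 'a" where
  "\<phi> i x = f (replicate i e @ x # replicate (k - Suc i) e)"

definition \<psi> :: "nat \<Rightarrow> 'a \<Rightarrow> 'a" where
  "\<psi> i = inv_into Q (\<phi> i)"

text \<open>The principal loop isotope at \<open>e\<close>, \<open>e\<close> of the binary operation
  that \<open>f\<close> induces on its first two arguments. Undoing the translations by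
  \<open>\<psi>\<close> is what turns \<open>f (replicate k e)\<close> into a unit.\<close>

definition G :: "'a monoid" where
  "G = \<lparr>carrier = Q, monoid.mult = (\<lambda>x y. f (\<psi> 0 x # \<psi> 1 y # replicate (k - 2) e)), monoid.one = f (replicate k e)\<rparr>"

lemma carrier_G [simp]: "carrier G = Q"
  by (simp add: G_def)

lemma bij_\<phi>: "i < k \<Longrightarrow> bij_betw (\<phi> i) Q Q"
proof (rule bij_betwI')
  fix y assume "i < k" "y \<in> Q"
  then have "\<exists>!x. x \<in> Q \<and> f (replicate i e @ x # replicate (k - Suc i) e) = y"
    by (intro unique_solution) (use e in auto)
  then show "\<exists>x\<in>Q. y = \<phi> i x"
    by (auto simp: \<phi>_def)
next
  fix x y assume "i < k" "x \<in> Q" "y \<in> Q"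
  then show "\<phi> i x = \<phi> i y \<longleftrightarrow> x = y"
    using f_cancel[of "replicate i e" "replicate (k - Suc i) e" x y] e by (auto simp: \<phi>_def)
next
  fix x assume "i < k" "x \<in> Q"
  then show "\<phi> i x \<in> Q"
    unfolding \<phi>_def by (intro f_closed) (use e in auto)
qed

lemma \<phi>_closed [simp]: "i < k \<Longrightarrow> x \<in> Q \<Longrightarrow> \<phi> i x \<in> Q"
  using bij_\<phi> bij_betwE by blast

lemma \<psi>_closed [simp]: "i < k \<Longrightarrow> x \<in> Q \<Longrightarrow> \<psi> i x \<in> Q"
  using bij_\<phi>[of i] unfolding \<psi>_def by (metis bij_betw_def inv_into_into)

lemma \<phi>_\<psi> [simp]: "i < k \<Longrightarrow> x \<in> Q \<Longrightarrow> \<phi> i (\<psi> i x) = x"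
  using bij_\<phi>[of i] unfolding \<psi>_def by (metis bij_betw_def f_inv_into_f)

lemma \<psi>_\<phi> [simp]: "i < k \<Longrightarrow> x \<in> Q \<Longrightarrow> \<psi> i (\<phi> i x) = x"
  using bij_\<phi>[of i] unfolding \<psi>_def by (metis bij_betw_def inv_into_f_f)

lemma one_closed [simp]: "\<one>\<^bsub>G\<^esub> \<in> Q"
  unfolding G_def by (auto intro: f_closed simp: e)

lemma \<phi>_e: "i < k \<Longrightarrow> \<phi> i e = \<one>\<^bsub>G\<^esub>"
proof -
  assume "i < k"
  then have "replicate k e = replicate i e @ e # replicate (k - Suc i) e"
    by (metis Suc_diff_Suc add_diff_inverse_nat not_less_iff_gr_or_eq replicate_Suc replicate_add)
  then show "\<phi> i e = \<one>\<^bsub>G\<^esub>"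
    by (simp add: \<phi>_def G_def)
qed

lemma mult_\<phi>:
  assumes "x \<in> Q" "y \<in> Q"
  shows "\<phi> 0 x \<otimes>\<^bsub>G\<^esub> \<phi> 1 y = f (x # y # replicate (k - 2) e)"
  using assms arity by (simp add: G_def)

lemma mult_closed: "x \<in> Q \<Longrightarrow> y \<in> Q \<Longrightarrow> x \<otimes>\<^bsub>G\<^esub> y \<in> Q"
  using arity e by (auto simp: G_def intro!: f_closed)

lemma one_mult:
  assumes "x \<in> Q" shows "\<one>\<^bsub>G\<^esub> \<otimes>\<^bsub>G\<^esub> x = x"
proof -
  have "\<one>\<^bsub>G\<^esub> \<otimes>\<^bsub>G\<^esub> x = f (e # \<psi> 1 x # replicate (k - 2) e)"
    using mult_\<phi>[of e "\<psi> 1 x"] assms arity e \<phi>_e[of 0] by simp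
  also have "\<dots> = \<phi> 1 (\<psi> 1 x)"
    unfolding \<phi>_def by (simp add: numeral_2_eq_2)
  finally show ?thesis
    using assms arity by simp
qed

text \<open>Two replacements of blocks bring the arguments into the form
  \<open>?w, ?y, e, ..., e\<close> that defines the product: first \<open>xs\<close> becomes
  \<open>?w, e, ..., e\<close>, then the block \<open>e, ..., e, x\<close> after \<open>?w\<close>
  becomes \<open>?y, e, ..., e\<close>. The elements \<open>?w\<close> and \<open>?y\<close> are
  chosen so that the values agree when all other arguments are \<open>e\<close>.\<close>

lemma f_snoc:
  assumes xs: "length xs = n" "n < k" "set xs \<subseteq> Q" and x: "x \<in> Q"
  shows "f (xs @ x # replicate (k - Suc n) e) = f (xs @ replicate (k - n) e) \<otimes>\<^bsub>G\<^esub> \<phi> n x"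
proof (cases n)
  case 0
  \<comment> \<open>The empty prefix is no block to be replaced; the left unit law takes
    over.\<close>
  have "\<one>\<^bsub>G\<^esub> \<otimes>\<^bsub>G\<^esub> \<phi> 0 x = \<phi> 0 x"
    by (rule one_mult) (use x arity in simp)
  moreover have "\<one>\<^bsub>G\<^esub> = f (replicate k e)"
    by (simp add: G_def)
  ultimately show ?thesis
    using xs 0 by (simp add: \<phi>_def)
next
  case (Suc n')
  let ?z = "f (xs @ replicate (k - n) e)"
  have "separable 0 n" "separable 1 (Suc n)"
    using xs Suc by (auto intro: separable)
  let ?w = "\<psi> 0 ?z" and ?y = "\<psi> 1 (\<phi> n x)"
  have z: "?z \<in> Q"
    by (rule f_closed) (use xs e in auto)
  have w: "?w \<in> Q" and y: "?y \<in> Q"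
    using z x xs arity by simp_all
  have rep: "replicate n' e @ replicate (k - n) e = replicate (k - 1) e"
    using xs Suc by (simp flip: replicate_add)
  have "f (?w # replicate n' e @ replicate (k - n) e) = ?z"
    using \<phi>_\<psi>[of 0 ?z] z arity by (simp add: \<phi>_def rep)
  then have "f ([] @ xs @ replicate (k - n) e) = f ([] @ (?w # replicate n' e) @ replicate (k - n) e)"
    by simp
  then have "f ([] @ xs @ (x # replicate (k - Suc n) e))
      = f ([] @ (?w # replicate n' e) @ (x # replicate (k - Suc n) e))"
    by (rule separableD[OF \<open>separable 0 n\<close>]) (use xs w x e Suc in auto)
  moreover
  \<comment> \<open>The second replacement is verified with \<open>e\<close> as first argument, and
    separability then exchanges this \<open>e\<close> for \<open>?w\<close>.\<close>
  have "f ([e] @ (replicate n' e @ [x]) @ replicate (k - Suc n) e) = \<phi> n x"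
    by (simp add: \<phi>_def Suc)
  moreover have "replicate n' e @ replicate (k - Suc n) e = replicate (k - 2) e"
    using xs Suc by (simp flip: replicate_add)
  moreover have "\<phi> 1 ?y = \<phi> n x"
    using x xs arity by simp
  ultimately have "f ([e] @ (replicate n' e @ [x]) @ replicate (k - Suc n) e)
      = f ([e] @ (?y # replicate n' e) @ replicate (k - Suc n) e)"
    by (simp add: \<phi>_def numeral_2_eq_2)
  then have "f ([?w] @ (replicate n' e @ [x]) @ replicate (k - Suc n) e)
      = f ([?w] @ (?y # replicate n' e) @ replicate (k - Suc n) e)"
    by (rule separableD[OF \<open>separable 1 (Suc n)\<close>]) (use xs w x y e Suc in auto)
  also have "\<dots> = f (?w # ?y # replicate (k - 2) e)"
    using \<open>replicate n' e @ replicate (k - Suc n) e = replicate (k - 2) e\<close> by simp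
  also have "\<dots> = ?z \<otimes>\<^bsub>G\<^esub> \<phi> n x"
    by (simp add: G_def)
  finally show ?thesis
    using \<open>f ([] @ xs @ (x # replicate (k - Suc n) e)) = _\<close> by simp
qed

lemma f_three:
  assumes "a \<in> Q" "b \<in> Q" "c \<in> Q"
  shows "f (a # b # c # replicate (k - 3) e) = (\<phi> 0 a \<otimes>\<^bsub>G\<^esub> \<phi> 1 b) \<otimes>\<^bsub>G\<^esub> \<phi> 2 c"
  using f_snoc[of "[a, b]" 2 c] mult_\<phi>[of a b] assms arity by (simp add: numeral_3_eq_3)

text \<open>The value of \<open>f\<close> at \<open>?a, ?b, ?c, e, ..., e\<close> is the left-hand
  side by \<open>f_three\<close>. With \<open>e\<close> in place of \<open>?a\<close>, the block
  \<open>?b, ?c\<close> gives the same value as \<open>?d, e\<close>, namely the product of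
  \<open>y\<close> and \<open>z\<close>. Separability restores \<open>?a\<close>, and the right-hand
  side appears.\<close>

lemma mult_assoc:
  assumes "x \<in> Q" "y \<in> Q" "z \<in> Q"
  shows "(x \<otimes>\<^bsub>G\<^esub> y) \<otimes>\<^bsub>G\<^esub> z = x \<otimes>\<^bsub>G\<^esub> (y \<otimes>\<^bsub>G\<^esub> z)"
proof -
  let ?a = "\<psi> 0 x" and ?b = "\<psi> 1 y" and ?c = "\<psi> 2 z" and ?d = "\<psi> 1 (y \<otimes>\<^bsub>G\<^esub> z)"
  have Q: "?a \<in> Q" "?b \<in> Q" "?c \<in> Q" "?d \<in> Q"
    using assms arity mult_closed by simp_all
  have "separable 1 3"
    using arity by (intro separable) simp_all
  have rep: "e # replicate (k - 3) e = replicate (k - 2) e"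
    using arity by (simp add: numeral_2_eq_2 numeral_3_eq_3 Suc_diff_Suc flip: replicate_Suc)
  have "f (e # ?b # ?c # replicate (k - 3) e) = y \<otimes>\<^bsub>G\<^esub> z"
    using f_three[of e ?b ?c] Q assms e arity one_mult by (simp add: \<phi>_e)
  also have "\<dots> = f (e # ?d # e # replicate (k - 3) e)"
    using mult_\<phi>[of e ?d] Q e assms arity mult_closed one_mult rep by (simp add: \<phi>_e)
  finally have "f ([e] @ [?b, ?c] @ replicate (k - 3) e) = f ([e] @ [?d, e] @ replicate (k - 3) e)"
    by simp
  then have "f ([?a] @ [?b, ?c] @ replicate (k - 3) e) = f ([?a] @ [?d, e] @ replicate (k - 3) e)"
    by (rule separableD[OF \<open>separable 1 3\<close>]) (use Q e arity in auto)
  then show ?thesis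
    using f_three[of ?a ?b ?c] mult_\<phi>[of ?a ?d] Q assms arity mult_closed rep by simp
qed

lemma group_G: "group G"
proof (rule groupI)
  fix x assume "x \<in> carrier G"
  \<comment> \<open>\<open>groupI\<close> asks for left inverses, so it is the first argument that
    is solved for; the inverse is \<open>\<phi> 0 w\<close>.\<close>
  have "\<exists>!w. w \<in> Q \<and> f ([] @ w # (\<psi> 1 x # replicate (k - 2) e)) = \<one>\<^bsub>G\<^esub>"
    by (rule unique_solution) (use \<open>x \<in> carrier G\<close> e arity in auto)
  then obtain w where "w \<in> Q" "f (w # \<psi> 1 x # replicate (k - 2) e) = \<one>\<^bsub>G\<^esub>"
    by auto
  then show "\<exists>y\<in>carrier G. y \<otimes>\<^bsub>G\<^esub> x = \<one>\<^bsub>G\<^esub>"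
    using \<open>x \<in> carrier G\<close> mult_\<phi>[of w "\<psi> 1 x"] arity by (intro bexI[of _ "\<phi> 0 w"]) auto
qed (use mult_closed mult_assoc one_mult in auto)

text \<open>The base point is replaced by the actual arguments one at a time from the left, each by
  \<open>f_snoc\<close>; the case \<open>n = k\<close> concerns \<open>f xs\<close> itself.\<close>

lemma f_eq_iterated_mult:
  assumes xs: "length xs = k" "set xs \<subseteq> Q" and "n \<le> k"
  shows "f (take n xs @ replicate (k - n) e) = iterated_mult G (map (\<lambda>i. \<phi> i (xs ! i)) [0..<n])"
  using \<open>n \<le> k\<close>
proof (induction n)
  case 0
  then show ?case by (simp add: iterated_mult_def G_def)
next
  case (Suc n)
  interpret group G by (rule group_G)
  have nth: "xs ! i \<in> Q" if "i < k" for i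
    using xs that by (metis nth_mem subsetD)
  have "f (take (Suc n) xs @ replicate (k - Suc n) e)
      = f (take n xs @ replicate (k - n) e) \<otimes>\<^bsub>G\<^esub> \<phi> n (xs ! n)"
    using f_snoc[of "take n xs" n "xs ! n"] xs Suc.prems nth set_take_subset[of n xs]
    by (simp add: take_Suc_conv_app_nth)
  then show ?case
    using Suc nth iterated_mult_snoc[of "map (\<lambda>i. \<phi> i (xs ! i)) [0..<n]" "\<phi> n (xs ! n)"] by force
qed

lemma isotopic_G: "isotopic k Q f (carrier G) (iterated_mult G)"
  unfolding isotopic_def
\<comment> \<open>The value needs no change, so the map with index 0 is \<open>id\<close>. The
  others are shifted by one because \<open>\<phi>\<close> counts arguments from 0.\<close>
proof (intro exI[of _ "\<lambda>i. case i of 0 \<Rightarrow> id | Suc i \<Rightarrow> \<phi> i"] conjI allI impI ballI)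
  fix i assume "i \<le> k"
  then show "bij_betw (case i of 0 \<Rightarrow> id | Suc i \<Rightarrow> \<phi> i) Q (carrier G)"
    using bij_\<phi> by (auto split: nat.split)
next
  fix xs assume "xs \<in> nlists k Q"
  then show "iterated_mult G (map (\<lambda>i. (case Suc i of 0 \<Rightarrow> id | Suc i \<Rightarrow> \<phi> i) (xs ! i)) [0..<k])
      = (case 0 of 0 \<Rightarrow> id | Suc i \<Rightarrow> \<phi> i) (f xs)"
    using f_eq_iterated_mult[of xs k] nlistsE_length[of xs k Q] nlistsE_set[of xs k Q] by simp
qed

end

theorem theorem8p2:
  fixes Q :: "'a set" and f :: "'a list \<Rightarrow> 'a" and k :: nat
  assumes "3 \<le> k"
    and "multary_quasigroup k Q f"
    and "three_connected (with_proj (factorization_graph k Q f))"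
  shows "\<exists>G :: 'a monoid. group G \<and> isotopic k Q f (carrier G) (iterated_mult G)"
proof -
  interpret multary k Q f by unfold_locales (rule assms(2))
  obtain e where "e \<in> Q"
    using assms(2) by (auto simp: multary_quasigroup_def)
  then interpret separable_multary k Q f e
    using assms all_separable by unfold_locales auto
  show ?thesis
    using group_G isotopic_G by blast
qed

end
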